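(* Let $\mathcal{C}$ be a small category with weak pullbacks. If an internal frame $L\in\mathsf{Frm}[\mathcal{C}^{op},\mathsf{Set}]$ is (internally) compact, then all its sections $La$, $a\in\mathcal{C}$, are compact frames.
   Context: For an arrow $f$ of $\mathcal{C}$, $\vartheta_0 f$ is its source and $\vartheta_1 f$ its target. An internal frame in $[\mathcal{C}^{op},\mathsf{Set}]$ is (described as) a functor $L$ from $\mathcal{C}^{op}$ to frames such that each $Lf\colon La\to Lb$ ($f\colon b\to a$) has a left adjoint $\Sigma_f\colon Lb\to La$ satisfying the Beck-Chevalley condition $Ls\circ\Sigma_r=\Sigma_q\circ Lp$ for every weak pullback square $rp=sq$ in $\mathcal{C}$, and Frobenius reciprocity $\Sigma_f(Lf(u)\wedge v)=u\wedge\Sigma_f v$. For a lattice $K$, $\mathrm{idl}\,K$ is the poset of ideals of $K$ (subsets containing $0$, downward closed, closed under binary joins) ordered by inclusion; for a map $h\colon K\to K'$ and $I\subseteq K$, $h[I]$ denotes the ideal generated by the direct image of $I$. A frame $K$ is compact if the only ideal $I$ of $K$ with $\bigvee I=1$ is $I=K$; that is, the equalizer of $\bigvee\colon\mathrm{idl}\,K\to K$ and the constant map with value $1$ is $\{K\}$. The internal ideal object of an internal frame $L$ is the presheaf of posets $\mathrm{idl}_{\hat{\mathcal{C}}}L$ with $$\mathrm{idl}_{\hat{\mathcal{C}}}L(a)=\Big\{(I_f)_{\vartheta_1 f=a}\ \Big|\ I_f\in\mathrm{idl}(L(\vartheta_0 f)),\ Lg[I_f]\subseteq I_{fg}\text{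 whenever }\vartheta_1 g=\vartheta_0 f\Big\},$$ ordered by componentwise inclusion, with transition along $r\colon b\to a$ given by $(I_f)_{\vartheta_1 f=a}\mapsto(I_{rh})_{\vartheta_1 h=b}$. The internal supremum map $S\colon\mathrm{idl}_{\hat{\mathcal{C}}}L\to L$ is $S_a((I_f)_{\vartheta_1 f=a})=\bigvee\bigcup_{\vartheta_1 f=a}\Sigma_f[I_f]$. The internal frame $L$ is (internally) compact if the equalizer in presheaves of $S$ and the constant map with value the top element consists only of the top internal ideal; i.e. for every $a$ and every $(I_f)_{\vartheta_1 f=a}\in\mathrm{idl}_{\hat{\mathcal{C}}}L(a)$ with $S_a((I_f)_{\vartheta_1 f=a})=1$, one has $I_f=L(\vartheta_0 f)$ for all $f$ with $\vartheta_1 f=a$. *)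

theory Defs
  imports "HOL-Algebra.Galois_Connection"
begin

section \<open>Small categories with weak pullbacks\<close>

text \<open>
  \<open>cmp C f g\<close> is the composite ``\<open>f\<close> after \<open>g\<close>'', written \<open>fg\<close>, and is meaningful only if
  \<open>tgt C g = src C f\<close>. Objects and arrows form sets, so every category in this sense is small.
\<close>

record ('o, 'm) small_cat =
  Ob :: "'o set"
  Ar :: "'m set"
  src :: "'m \<Rightarrow> 'o"
  tgt :: "'m \<Rightarrow> 'o"
  idt :: "'o \<Rightarrow> 'm"
  cmp :: "'m \<Rightarrow> 'm \<Rightarrow> 'm"

locale small_category =
  fixes C :: "('o, 'm) small_cat"
  assumes src_closed: "f \<in> Ar C \<Longrightarrow> src C f \<in> Ob C"
    and tgt_closed: "f \<in> Ar C \<Longrightarrow> tgt C f \<in> Ob C"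
    and idt_closed: "a \<in> Ob C \<Longrightarrow> idt C a \<in> Ar C"
    and src_idt: "a \<in> Ob C \<Longrightarrow> src C (idt C a) = a"
    and tgt_idt: "a \<in> Ob C \<Longrightarrow> tgt C (idt C a) = a"
    and cmp_closed: "\<lbrakk>f \<in> Ar C; g \<in> Ar C; tgt C g = src C f\<rbrakk> \<Longrightarrow> cmp C f g \<in> Ar C"
    and src_cmp: "\<lbrakk>f \<in> Ar C; g \<in> Ar C; tgt C g = src C f\<rbrakk> \<Longrightarrow> src C (cmp C f g) = src C g"
    and tgt_cmp: "\<lbrakk>f \<in> Ar C; g \<in> Ar C; tgt C g = src C f\<rbrakk> \<Longrightarrow> tgt C (cmp C f g) = tgt C f"
    and idt_left: "f \<in> Ar C \<Longrightarrow> cmp C (idt C (tgt C f)) f = f"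
    and idt_right: "f \<in> Ar C \<Longrightarrow> cmp C f (idt C (src C f)) = f"
    and cmp_assoc: "\<lbrakk>f \<in> Ar C; g \<in> Ar C; h \<in> Ar C; tgt C g = src C f; tgt C h = src C g\<rbrakk>
      \<Longrightarrow> cmp C (cmp C f g) h = cmp C f (cmp C g h)"

definition commutative_square :: "('o, 'm) small_cat \<Rightarrow> 'm \<Rightarrow> 'm \<Rightarrow> 'm \<Rightarrow> 'm \<Rightarrow> bool" where
  "commutative_square C r p s q \<longleftrightarrow>
     r \<in> Ar C \<and> p \<in> Ar C \<and> s \<in> Ar C \<and> q \<in> Ar C \<and>
     tgt C r = tgt C s \<and> tgt C p = src C r \<and> tgt C q = src C s \<and> src C p = src C q \<and>
     cmp C r p = cmp C s q"

text \<open>As for a pullback, but the mediating arrow \<open>u\<close> need not be unique.\<close>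

definition weak_pullback :: "('o, 'm) small_cat \<Rightarrow> 'm \<Rightarrow> 'm \<Rightarrow> 'm \<Rightarrow> 'm \<Rightarrow> bool" where
  "weak_pullback C r p s q \<longleftrightarrow>
     commutative_square C r p s q \<and>
     (\<forall>p' q'. commutative_square C r p' s q' \<longrightarrow>
        (\<exists>u\<in>Ar C. src C u = src C p' \<and> tgt C u = src C p \<and> cmp C p u = p' \<and> cmp C q u = q'))"

definition has_weak_pullbacks :: "('o, 'm) small_cat \<Rightarrow> bool" where
  "has_weak_pullbacks C \<longleftrightarrow>
     (\<forall>r\<in>Ar C. \<forall>s\<in>Ar C. tgt C r = tgt C s \<longrightarrow> (\<exists>p q. weak_pullback C r p s q))"

section \<open>Frames, ideals and compactness\<close>

locale frame = complete_lattice L for L (structure) +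
  assumes frame_distrib: "\<lbrakk>x \<in> carrier L; A \<subseteq> carrier L\<rbrakk>
    \<Longrightarrow> x \<sqinter> (\<Squnion>A) = \<Squnion>((\<lambda>y. x \<sqinter> y) ` A)"

definition frame_hom :: "'e gorder \<Rightarrow> 'f gorder \<Rightarrow> ('e \<Rightarrow> 'f) \<Rightarrow> bool" where
  "frame_hom K K' h \<longleftrightarrow>
     h \<in> carrier K \<rightarrow> carrier K' \<and>
     h \<top>\<^bsub>K\<^esub> = \<top>\<^bsub>K'\<^esub> \<and>
     meet_pres K K' h \<and>
     sup_pres K K' h"

definition lattice_ideal :: "'e gorder \<Rightarrow> 'e set \<Rightarrow> bool" where
  "lattice_ideal K I \<longleftrightarrow>
     I \<subseteq> carrier K \<and> \<bottom>\<^bsub>K\<^esub> \<in> I \<and>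
     (\<forall>x\<in>carrier K. \<forall>y\<in>I. x \<sqsubseteq>\<^bsub>K\<^esub> y \<longrightarrow> x \<in> I) \<and>
     (\<forall>x\<in>I. \<forall>y\<in>I. x \<squnion>\<^bsub>K\<^esub> y \<in> I)"

definition idl :: "'e gorder \<Rightarrow> 'e set gorder" where
  "idl K = \<lparr>carrier = {I. lattice_ideal K I}, eq = (=), le = (\<subseteq>)\<rparr>"

text \<open>The ideal \<open>h[I]\<close> of \<open>K'\<close> generated by the direct image of \<open>I\<close> under a map \<open>h\<close> into \<open>K'\<close>.\<close>

definition image_ideal :: "'f gorder \<Rightarrow> ('e \<Rightarrow> 'f) \<Rightarrow> 'e set \<Rightarrow> 'f set" where
  "image_ideal K' h I = \<Inter>{J \<in> carrier (idl K'). h ` I \<subseteq> J}"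

locale compact_frame = frame L for L :: "'e gorder" (structure) +
  assumes compact: "\<lbrakk>I \<in> carrier (idl L); \<Squnion>I = \<top>\<rbrakk> \<Longrightarrow> I = carrier L"

section \<open>Internal frames in presheaves\<close>

text \<open>
  \<open>L\<close> and \<open>R\<close> are the object and arrow parts of a functor from the opposite of \<open>C\<close> to frames: for
  \<open>f\<close> from \<open>b\<close> to \<open>a\<close>, \<open>R f\<close> is the transition map \<open>L a \<rightarrow> L b\<close>, and \<open>\<Sigma> f\<close> is its left
  adjoint \<open>L b \<rightarrow> L a\<close>. The functions \<open>R f\<close> and \<open>\<Sigma> f\<close> matter only on the carriers, where \<open>\<Sigma> f\<close>
  is uniquely determined by \<open>R f\<close>. All sections take their elements from one common type, which
  is no restriction since any set of frames embeds into their disjoint union.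
\<close>

locale internal_frame = small_category C
  for C :: "('o, 'm) small_cat" +
  fixes L :: "'o \<Rightarrow> 'e gorder"
    and R :: "'m \<Rightarrow> 'e \<Rightarrow> 'e"
    and \<Sigma> :: "'m \<Rightarrow> 'e \<Rightarrow> 'e"
  assumes section_frame: "a \<in> Ob C \<Longrightarrow> frame (L a)"
    and transition_hom: "f \<in> Ar C \<Longrightarrow> frame_hom (L (tgt C f)) (L (src C f)) (R f)"
    and transition_idt: "\<lbrakk>a \<in> Ob C; u \<in> carrier (L a)\<rbrakk> \<Longrightarrow> R (idt C a) u = u"
    and transition_cmp: "\<lbrakk>f \<in> Ar C; g \<in> Ar C; tgt C g = src C f; u \<in> carrier (L (tgt C f))\<rbrakk>
      \<Longrightarrow> R (cmp C f g) u = R g (R f u)"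
    and left_adjoint: "f \<in> Ar C \<Longrightarrow>
      galois_connection \<lparr>orderA = L (src C f), orderB = L (tgt C f), lower = \<Sigma> f, upper = R f\<rparr>"
    and beck_chevalley: "\<lbrakk>weak_pullback C r p s q; u \<in> carrier (L (src C r))\<rbrakk>
      \<Longrightarrow> R s (\<Sigma> r u) = \<Sigma> q (R p u)"
    and frobenius: "\<lbrakk>f \<in> Ar C; u \<in> carrier (L (tgt C f)); v \<in> carrier (L (src C f))\<rbrakk>
      \<Longrightarrow> \<Sigma> f (R f u \<sqinter>\<^bsub>L (src C f)\<^esub> v) = u \<sqinter>\<^bsub>L (tgt C f)\<^esub> \<Sigma> f v"

definition arrows_to :: "('o, 'm) small_cat \<Rightarrow> 'o \<Rightarrow> 'm set" where
  "arrows_to C a = {f \<in> Ar C. tgt C f = a}"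

text \<open>
  The internal ideal object, given by its posets of sections and its transition maps. A family
  indexed by the arrows into \<open>a\<close> is a function that is \<open>undefined\<close> off this index set.
\<close>

definition internal_idl ::
  "('o, 'm) small_cat \<Rightarrow> ('o \<Rightarrow> 'e gorder) \<Rightarrow> ('m \<Rightarrow> 'e \<Rightarrow> 'e) \<Rightarrow> 'o \<Rightarrow> ('m \<Rightarrow> 'e set) gorder" where
  "internal_idl C L R a =
     \<lparr>carrier = {I \<in> (\<Pi>\<^sub>E f\<in>arrows_to C a. carrier (idl (L (src C f)))).
        \<forall>f\<in>arrows_to C a. \<forall>g\<in>arrows_to C (src C f).
          image_ideal (L (src C g)) (R g) (I f) \<subseteq> I (cmp C f g)},
      eq = (=),
      le = (\<lambda>I J. \<forall>f\<in>arrows_to C a. I f \<subseteq> J f)\<rparr>"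

definition internal_idl_transition ::
  "('o, 'm) small_cat \<Rightarrow> 'm \<Rightarrow> ('m \<Rightarrow> 'e set) \<Rightarrow> ('m \<Rightarrow> 'e set)" where
  "internal_idl_transition C r I = (\<lambda>h\<in>arrows_to C (src C r). I (cmp C r h))"

definition internal_sup ::
  "('o, 'm) small_cat \<Rightarrow> ('o \<Rightarrow> 'e gorder) \<Rightarrow> ('m \<Rightarrow> 'e \<Rightarrow> 'e) \<Rightarrow> 'o \<Rightarrow> ('m \<Rightarrow> 'e set) \<Rightarrow> 'e" where
  "internal_sup C L \<Sigma> a I = \<Squnion>\<^bsub>L a\<^esub>(\<Union>f\<in>arrows_to C a. image_ideal (L a) (\<Sigma> f) (I f))"

definition internally_compact ::
  "('o, 'm) small_cat \<Rightarrow> ('o \<Rightarrow> 'e gorder) \<Rightarrow> ('m \<Rightarrow> 'e \<Rightarrow> 'e) \<Rightarrow> ('m \<Rightarrow> 'e \<Rightarrow> 'e) \<Rightarrow> bool" where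
  "internally_compact C L R \<Sigma> \<longleftrightarrow>
     (\<forall>a\<in>Ob C. \<forall>I\<in>carrier (internal_idl C L R a).
        internal_sup C L \<Sigma> a I = \<top>\<^bsub>L a\<^esub> \<longrightarrow> (\<forall>f\<in>arrows_to C a. I f = carrier (L (src C f))))"

end

theory Submission
  imports Defs
begin

text \<open>
  Internal compactness at stage \<open>a\<close> is a condition on families of ideals indexed by all arrows
  into \<open>a\<close>; compactness of \<open>L a\<close> is the same condition on a single ideal. The two are linked by
  extending an ideal \<open>I\<close> of \<open>L a\<close> along every arrow: \<open>I\<close> generates the family of the ideals
  \<open>Lf[I]\<close>. This is an internal ideal because transition maps preserve finite joins, so that
  \<open>Lg[Lf[I]] \<subseteq> L(fg)[I]\<close> (\<open>image_ideal_comp_subset\<close>, \<open>extension_family_internal_idl\<close>). Its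
  component at the identity of \<open>a\<close> is \<open>I\<close> itself, and \<open>\<Sigma>\<close> of an identity is an identity, so the
  internal supremum of the family dominates \<open>\<Squnion>I\<close> (\<open>internal_sup_extension_family_top\<close>). If
  \<open>\<Squnion>I\<close> is the top element, internal compactness makes every component the full ideal, and
  reading this off at the identity gives \<open>I = L a\<close>.
\<close>

section \<open>Ideals generated by direct images\<close>

lemma mem_carrier_idl: "I \<in> carrier (idl K) \<longleftrightarrow> lattice_ideal K I"
  by (simp add: idl_def)

lemma lattice_ideal_carrier:
  assumes "complete_lattice K"
  shows "lattice_ideal K (carrier K)"
proof -
  interpret complete_lattice K by fact
  show ?thesis by (auto simp: lattice_ideal_def)
qed

lemma image_subset_image_ideal: "h ` I \<subseteq> image_ideal K h I"
  by (auto simp: image_ideal_def)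

lemma image_ideal_least: "lattice_ideal K J \<Longrightarrow> h ` I \<subseteq> J \<Longrightarrow> image_ideal K h I \<subseteq> J"
  by (auto simp: image_ideal_def mem_carrier_idl)

lemma image_ideal_cong: "(\<And>x. x \<in> I \<Longrightarrow> h x = k x) \<Longrightarrow> image_ideal K h I = image_ideal K k I"
  by (simp add: image_ideal_def cong: image_cong)

lemma image_ideal_eqI: "lattice_ideal K I \<Longrightarrow> (\<And>x. x \<in> I \<Longrightarrow> h x = x) \<Longrightarrow> image_ideal K h I = I"
  using image_ideal_least[of K I h I] image_subset_image_ideal[of h I K] by force

text \<open>
  The hypothesis on \<open>h\<close> puts the full ideal among those being intersected; an empty intersection
  would be the whole type instead of an ideal.
\<close>

lemma lattice_ideal_image_ideal:
  assumes "complete_lattice K" and "h ` I \<subseteq> carrier K"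
  shows "lattice_ideal K (image_ideal K h I)"
proof -
  have "image_ideal K h I \<subseteq> carrier K"
    using lattice_ideal_carrier[OF assms(1)] assms(2) by (rule image_ideal_least)
  moreover have "\<bottom>\<^bsub>K\<^esub> \<in> image_ideal K h I"
    by (simp add: image_ideal_def mem_carrier_idl lattice_ideal_def)
  moreover have "x \<in> image_ideal K h I"
    if "x \<in> carrier K" "y \<in> image_ideal K h I" "x \<sqsubseteq>\<^bsub>K\<^esub> y" for x y
    using that unfolding image_ideal_def mem_carrier_idl lattice_ideal_def by blast
  moreover have "x \<squnion>\<^bsub>K\<^esub> y \<in> image_ideal K h I"
    if "x \<in> image_ideal K h I" "y \<in> image_ideal K h I" for x y
    using that by (simp add: image_ideal_def mem_carrier_idl lattice_ideal_def)
  ultimately show ?thesis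
    unfolding lattice_ideal_def by blast
qed

lemma frame_hom_bottom:
  assumes "frame_hom K K' h"
  shows "h \<bottom>\<^bsub>K\<^esub> = \<bottom>\<^bsub>K'\<^esub>"
proof -
  interpret K: complete_lattice K using assms by (simp add: frame_hom_def sup_pres_def)
  interpret K': complete_lattice K' using assms by (simp add: frame_hom_def sup_pres_def)
  have "\<bottom>\<^bsub>K\<^esub> = \<Squnion>\<^bsub>K\<^esub>{}" "\<bottom>\<^bsub>K'\<^esub> = \<Squnion>\<^bsub>K'\<^esub>{}"
    by (simp_all add: bottom_def sup_def)
  then show ?thesis
    using assms by (simp add: frame_hom_def sup_pres_def)
qed

lemma lattice_ideal_vimage:
  assumes h: "frame_hom K K' h" and J: "lattice_ideal K' J"
  shows "lattice_ideal K {x \<in> carrier K. h x \<in> J}"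
proof -
  interpret K: complete_lattice K using h by (simp add: frame_hom_def sup_pres_def)
  have closed: "h x \<in> carrier K'" if "x \<in> carrier K" for x
    using h that by (auto simp: frame_hom_def)
  have join: "join_pres K K' h"
    using h by (simp add: frame_hom_def weak_sup_pres sup_pres_is_join_pres)
  have mono: "h x \<sqsubseteq>\<^bsub>K'\<^esub> h y" if "x \<in> carrier K" "y \<in> carrier K" "x \<sqsubseteq>\<^bsub>K\<^esub> y" for x y
    using join_pres_isotone[OF _ join] h that by (auto simp: frame_hom_def intro: use_iso2)
  show ?thesis
    unfolding lattice_ideal_def
  proof (intro conjI ballI impI)
    show "{x \<in> carrier K. h x \<in> J} \<subseteq> carrier K" by auto
    show "\<bottom>\<^bsub>K\<^esub> \<in> {x \<in> carrier K. h x \<in> J}"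
      using J frame_hom_bottom[OF h] by (simp add: lattice_ideal_def)
  next
    fix x y assume "x \<in> carrier K" "y \<in> {x \<in> carrier K. h x \<in> J}" "x \<sqsubseteq>\<^bsub>K\<^esub> y"
    then show "x \<in> {x \<in> carrier K. h x \<in> J}"
      using J mono closed unfolding lattice_ideal_def by blast
  next
    fix x y assume "x \<in> {x \<in> carrier K. h x \<in> J}" "y \<in> {x \<in> carrier K. h x \<in> J}"
    then show "x \<squnion>\<^bsub>K\<^esub> y \<in> {x \<in> carrier K. h x \<in> J}"
      using J join by (simp add: lattice_ideal_def join_pres_def)
  qed
qed

text \<open>
  The preimage under \<open>h\<close> of the right-hand side is an ideal containing the image of \<open>k\<close>, hence
  contains \<open>k[I]\<close>.
\<close>

lemma image_ideal_comp_subset: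
  assumes h: "frame_hom K K' h" and k: "k ` I \<subseteq> carrier K"
  shows "image_ideal K' h (image_ideal K k I) \<subseteq> image_ideal K' (h \<circ> k) I"
proof -
  let ?J = "image_ideal K' (h \<circ> k) I"
  have cl': "complete_lattice K'"
    using h by (simp add: frame_hom_def sup_pres_def)
  have "(h \<circ> k) ` I \<subseteq> carrier K'"
    using h k by (auto simp: frame_hom_def)
  with cl' have J: "lattice_ideal K' ?J"
    by (rule lattice_ideal_image_ideal)
  have "k ` I \<subseteq> {x \<in> carrier K. h x \<in> ?J}"
    using k image_subset_image_ideal[of "h \<circ> k" I K'] by auto
  with lattice_ideal_vimage[OF h J] have "image_ideal K k I \<subseteq> {x \<in> carrier K. h x \<in> ?J}"
    by (rule image_ideal_least)
  then have "h ` image_ideal K k I \<subseteq> ?J"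
    by blast
  with J show ?thesis
    by (rule image_ideal_least)
qed

section \<open>The internal ideal generated by an ideal of a section\<close>

definition extension_family ::
  "('o, 'm) small_cat \<Rightarrow> ('o \<Rightarrow> 'e gorder) \<Rightarrow> ('m \<Rightarrow> 'e \<Rightarrow> 'e) \<Rightarrow> 'o \<Rightarrow> 'e set \<Rightarrow> ('m \<Rightarrow> 'e set)" where
  "extension_family C L R a I = (\<lambda>f\<in>arrows_to C a. image_ideal (L (src C f)) (R f) I)"

context internal_frame
begin

lemma section_complete_lattice: "a \<in> Ob C \<Longrightarrow> complete_lattice (L a)"
  using section_frame by (auto simp: frame_def)

lemma idt_arrows_to: "a \<in> Ob C \<Longrightarrow> idt C a \<in> arrows_to C a"
  by (simp add: arrows_to_def idt_closed tgt_idt)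

lemma transition_image_subset:
  assumes "lattice_ideal (L a) I" and "f \<in> arrows_to C a"
  shows "R f ` I \<subseteq> carrier (L (src C f))"
  using assms transition_hom[of f]
  by (auto simp: arrows_to_def frame_hom_def lattice_ideal_def)

lemma left_adjoint_closed:
  "f \<in> Ar C \<Longrightarrow> v \<in> carrier (L (src C f)) \<Longrightarrow> \<Sigma> f v \<in> carrier (L (tgt C f))"
  using connection.lower_closed[OF galois_connection.axioms(1)[OF left_adjoint]] by simp

text \<open>Left adjoints are unique, and the transition map along an identity is an identity.\<close>

lemma left_adjoint_idt:
  assumes a: "a \<in> Ob C" and u: "u \<in> carrier (L a)"
  shows "\<Sigma> (idt C a) u = u"
proof -
  interpret complete_lattice "L a" using a by (rule section_complete_lattice)
  have gc: "galois_connection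
      \<lparr>orderA = L a, orderB = L a, lower = \<Sigma> (idt C a), upper = R (idt C a)\<rparr>"
    using left_adjoint[OF idt_closed[OF a]] a by (simp add: src_idt tgt_idt)
  have closed: "\<Sigma> (idt C a) u \<in> carrier (L a)"
    using left_adjoint_closed[OF idt_closed[OF a]] a u by (simp add: src_idt tgt_idt)
  have "\<Sigma> (idt C a) u \<sqsubseteq>\<^bsub>L a\<^esub> u"
    using galois_connection.deflation[OF gc] transition_idt[OF a] u by auto
  moreover have "u \<sqsubseteq>\<^bsub>L a\<^esub> \<Sigma> (idt C a) u"
    using galois_connection.inflation[OF gc, of u] transition_idt[OF a closed] u by simp
  ultimately show ?thesis
    using closed u by (rule le_antisym)
qed

lemma extension_family_internal_idl:
  assumes a: "a \<in> Ob C" and I: "lattice_ideal (L a) I"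
  shows "extension_family C L R a I \<in> carrier (internal_idl C L R a)"
proof -
  have ideal: "image_ideal (L (src C f)) (R f) I \<in> carrier (idl (L (src C f)))"
    if f: "f \<in> arrows_to C a" for f
    using lattice_ideal_image_ideal[OF section_complete_lattice transition_image_subset[OF I f]] f
    by (simp add: mem_carrier_idl arrows_to_def src_closed)
  have comp: "image_ideal (L (src C g)) (R g) (image_ideal (L (src C f)) (R f) I)
      \<subseteq> image_ideal (L (src C (cmp C f g))) (R (cmp C f g)) I"
    if f: "f \<in> arrows_to C a" and g: "g \<in> arrows_to C (src C f)" for f g
  proof -
    have fg: "f \<in> Ar C" "g \<in> Ar C" "tgt C g = src C f" "tgt C f = a"
      using f g by (simp_all add: arrows_to_def)
    have "image_ideal (L (src C g)) (R g) (image_ideal (L (src C f)) (R f) I)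
        \<subseteq> image_ideal (L (src C g)) (R g \<circ> R f) I"
      using transition_hom[OF fg(2)] transition_image_subset[OF I f] fg(3)
      by (intro image_ideal_comp_subset) simp_all
    also have "\<dots> = image_ideal (L (src C g)) (R (cmp C f g)) I"
      using I fg by (intro image_ideal_cong) (auto simp: transition_cmp lattice_ideal_def)
    finally show ?thesis
      using fg by (simp add: src_cmp)
  qed
  have "cmp C f g \<in> arrows_to C a" if "f \<in> arrows_to C a" "g \<in> arrows_to C (src C f)" for f g
    using that by (simp add: arrows_to_def cmp_closed tgt_cmp)
  with ideal comp show ?thesis
    by (simp add: internal_idl_def extension_family_def)
qed

lemma extension_family_idt:
  assumes a: "a \<in> Ob C" and I: "lattice_ideal (L a) I"
  shows "extension_family C L R a I (idt C a) = I"
proof -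
  have "image_ideal (L a) (R (idt C a)) I = I"
    using I transition_idt[OF a] by (intro image_ideal_eqI) (auto simp: lattice_ideal_def)
  then show ?thesis
    using a by (simp add: extension_family_def idt_arrows_to src_idt)
qed

text \<open>The summand of the internal supremum at the identity arrow already contains \<open>I\<close>.\<close>

lemma internal_sup_extension_family_top:
  assumes a: "a \<in> Ob C" and I: "lattice_ideal (L a) I" and top: "\<Squnion>\<^bsub>L a\<^esub>I = \<top>\<^bsub>L a\<^esub>"
  shows "internal_sup C L \<Sigma> a (extension_family C L R a I) = \<top>\<^bsub>L a\<^esub>"
proof -
  interpret complete_lattice "L a" using a by (rule section_complete_lattice)
  let ?E = "extension_family C L R a I"
  let ?U = "\<Union>f\<in>arrows_to C a. image_ideal (L a) (\<Sigma> f) (?E f)"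
  have IL: "I \<subseteq> carrier (L a)"
    using I by (simp add: lattice_ideal_def)
  have U: "?U \<subseteq> carrier (L a)"
  proof (rule UN_least)
    fix f assume f: "f \<in> arrows_to C a"
    then have "lattice_ideal (L (src C f)) (?E f)"
      using extension_family_internal_idl[OF a I]
      by (auto simp: internal_idl_def mem_carrier_idl)
    then have "\<Sigma> f ` ?E f \<subseteq> carrier (L a)"
      using f left_adjoint_closed by (auto simp: lattice_ideal_def arrows_to_def)
    with lattice_ideal_carrier[OF section_complete_lattice[OF a]]
    show "image_ideal (L a) (\<Sigma> f) (?E f) \<subseteq> carrier (L a)"
      by (rule image_ideal_least)
  qed
  have IU: "I \<subseteq> ?U"
  proof
    fix x assume x: "x \<in> I"
    then have "\<Sigma> (idt C a) x \<in> image_ideal (L a) (\<Sigma> (idt C a)) (?E (idt C a))"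
      using image_subset_image_ideal extension_family_idt[OF a I] by fastforce
    then show "x \<in> ?U"
      using x IL left_adjoint_idt[OF a] idt_arrows_to[OF a] by force
  qed
  have "\<Squnion>\<^bsub>L a\<^esub>I \<sqsubseteq>\<^bsub>L a\<^esub> \<Squnion>\<^bsub>L a\<^esub>?U"
  proof (rule sup_least[OF IL sup_closed[OF U]])
    fix x assume "x \<in> I"
    with IU have "x \<in> ?U" by (rule subsetD)
    with U show "x \<sqsubseteq>\<^bsub>L a\<^esub> \<Squnion>\<^bsub>L a\<^esub>?U" by (rule sup_upper)
  qed
  then have "\<top>\<^bsub>L a\<^esub> \<sqsubseteq>\<^bsub>L a\<^esub> \<Squnion>\<^bsub>L a\<^esub>?U"
    by (simp only: top)
  then have "\<Squnion>\<^bsub>L a\<^esub>?U = \<top>\<^bsub>L a\<^esub>"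
    using sup_closed[OF U] by (intro le_antisym top_higher top_closed)
  then show ?thesis
    by (simp add: internal_sup_def)
qed

end

theorem proposition3p9:
  fixes C :: "('o, 'm) small_cat"
    and L :: "'o \<Rightarrow> 'e gorder"
    and R :: "'m \<Rightarrow> 'e \<Rightarrow> 'e"
    and \<Sigma> :: "'m \<Rightarrow> 'e \<Rightarrow> 'e"
  assumes "small_category C"
    and "has_weak_pullbacks C"
    and "internal_frame C L R \<Sigma>"
    and "internally_compact C L R \<Sigma>"
  shows "\<forall>a\<in>Ob C. compact_frame (L a)"
proof
  fix a assume a: "a \<in> Ob C"
  interpret internal_frame C L R \<Sigma> by fact
  have "I = carrier (L a)"
    if "I \<in> carrier (idl (L a))" and top: "\<Squnion>\<^bsub>L a\<^esub>I = \<top>\<^bsub>L a\<^esub>" for I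
  proof -
    have I: "lattice_ideal (L a) I"
      using that by (simp add: mem_carrier_idl)
    have "extension_family C L R a I (idt C a) = carrier (L (src C (idt C a)))"
      using assms(4) a extension_family_internal_idl[OF a I]
        internal_sup_extension_family_top[OF a I top] idt_arrows_to[OF a]
      unfolding internally_compact_def by blast
    then show ?thesis
      using extension_family_idt[OF a I] a by (simp add: src_idt)
  qed
  with section_frame[OF a] show "compact_frame (L a)"
    by (simp add: compact_frame_def compact_frame_axioms_def)
qed

end
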